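(* Let $n\in(2,3)$. There is a positive constant $c_p$ independent of $h>0$ such that for every strictly positive $u^h\in X_h$ with $E_h[u^h]\le c_Fh^{-(p-2)/(p+2)}$ $$A^h_\Delta\big(u^h,-\mathcal I_h[(u^h)^{-p-1}]\big)\ge c_p(n-2)\,h\sum_{i=1}^{L_h}(u^h_i)^{n-p-4}\Big|\tfrac{u^h_{i+1}-u^h_i}{h}\Big|^2.$$
   Context: $L>0$, $\mathcal O=(0,L)$ with periodic boundary conditions, $h>0$ with $L_h:=L/h\in\mathbb N$. $X_h$ is the space of $L$-periodic continuous functions that are linear on each $[(i-1)h,ih]$; $v_i:=v(ih)$ with periodic indices; $\mathcal I_h$ is nodal interpolation into $X_h$. $F(u)=c_Fu^{-p}$ for $u>0$, with $c_F>0$ and $p>n$; $E_h[v]:=\int_{\mathcal O}\frac12|v_x|^2+\mathcal I_h[F(v)]\,dx$. For positive $u^h\in X_h$ and $v^h\in X_h$: $A^h_\Delta(u^h,v^h)=-\frac{n-2}{6}h\sum_{i=1}^{L_h}(u^h_i)^{n-3}\big(|\frac{u^h_i-u^h_{i-1}}h|^2+|\frac{u^h_{i+1}-u^h_i}h|^2\big)v^h_i-\frac{n-2}{6}h\sum_{i=1}^{L_h}\big\{((u^h_i)^{n-3}+(u^h_{i+1})^{n-3})\frac{u^h_{i+1}-u^h_i}{h}+((u^h_{i-1})^{n-3}+(u^h_i)^{n-3})\frac{u^h_i-u^h_{i-1}}{h}\big\}\frac{u^h_{i+1}-u^h_{i-1}}{2h}v^h_i$. *)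

theory Defs
  imports "HOL-Analysis.Analysis"
begin

definition fe_space :: "real \<Rightarrow> real \<Rightarrow> (real \<Rightarrow> real) set" where
  "fe_space L h = {v. continuous_on UNIV v \<and> (\<forall>x. v (x + L) = v x) \<and>
     (\<forall>i::int. \<exists>a b. \<forall>x\<in>{of_int (i - 1) * h..of_int i * h}. v x = a * x + b)}"

text \<open>Indices range over all integers; for an L-periodic function and h dividing L this
  is the periodic index convention.\<close>

definition nodal :: "real \<Rightarrow> (real \<Rightarrow> real) \<Rightarrow> int \<Rightarrow> real" where
  "nodal h v i = v (of_int i * h)"

definition num_cells :: "real \<Rightarrow> real \<Rightarrow> int" where
  "num_cells L h = \<lfloor>L / h\<rfloor>"

text \<open>On the cell from i h to (i + 1) h, the convex combination of the two nodal values.\<close>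

definition interp :: "real \<Rightarrow> (real \<Rightarrow> real) \<Rightarrow> real \<Rightarrow> real" where
  "interp h g x = (1 - frac (x / h)) * nodal h g \<lfloor>x / h\<rfloor> + frac (x / h) * nodal h g (\<lfloor>x / h\<rfloor> + 1)"

definition F :: "real \<Rightarrow> real \<Rightarrow> real \<Rightarrow> real" where
  "F cF p u = cF * u powr (- p)"

text \<open>An element of the finite element space is differentiable off the nodes, so the pointwise
  derivative agrees almost everywhere with the weak one.\<close>

definition energy :: "real \<Rightarrow> real \<Rightarrow> real \<Rightarrow> real \<Rightarrow> (real \<Rightarrow> real) \<Rightarrow> real" where
  "energy L cF p h v =
     (LBINT x:{0<..<L}. 1 / 2 * \<bar>deriv v x\<bar>\<^sup>2 + interp h (\<lambda>y. F cF p (v y)) x)"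

definition A_Delta :: "real \<Rightarrow> real \<Rightarrow> real \<Rightarrow> (real \<Rightarrow> real) \<Rightarrow> (real \<Rightarrow> real) \<Rightarrow> real" where
  "A_Delta L n h u v =
     (let U = nodal h u; V = nodal h v in
       - ((n - 2) / 6) * h * (\<Sum>i=1..num_cells L h.
           U i powr (n - 3)
           * (\<bar>(U i - U (i - 1)) / h\<bar>\<^sup>2 + \<bar>(U (i + 1) - U i) / h\<bar>\<^sup>2) * V i)
       - ((n - 2) / 6) * h * (\<Sum>i=1..num_cells L h.
           ((U i powr (n - 3) + U (i + 1) powr (n - 3)) * ((U (i + 1) - U i) / h)
            + (U (i - 1) powr (n - 3) + U i powr (n - 3)) * ((U i - U (i - 1)) / h))
           * ((U (i + 1) - U (i - 1)) / (2 * h)) * V i))"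

lemma nodal_interp: "h > 0 \<Longrightarrow> nodal h (interp h g) i = nodal h g i"
  by (simp add: nodal_def interp_def)

lemma interp_on_cell:
  assumes h: "h > 0" and x: "x \<in> {of_int (i - 1) * h..of_int i * h}"
  shows "interp h g x = (of_int i - x / h) * nodal h g (i - 1) + (x / h - of_int (i - 1)) * nodal h g i"
proof (cases "x = of_int i * h")
  case True
  then show ?thesis using h by (simp add: interp_def)
next
  case False
  with x h have "of_int (i - 1) \<le> x / h" "x / h < of_int i"
    by (auto simp: field_simps)
  then have fl: "\<lfloor>x / h\<rfloor> = i - 1" by (simp add: floor_eq_iff)
  show ?thesis unfolding interp_def frac_def fl by (simp add: algebra_simps)
qed

lemma interp_affine_on_cell:
  assumes h: "h > 0"
  shows "\<exists>a b. \<forall>x\<in>{of_int (i - 1) * h..of_int i * h}. interp h g x = a * x + b"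
  by (rule exI[of _ "(nodal h g i - nodal h g (i - 1)) / h"],
      rule exI[of _ "of_int i * nodal h g (i - 1) - of_int (i - 1) * nodal h g i"])
     (use interp_on_cell[OF h] in \<open>auto simp: algebra_simps diff_divide_distrib\<close>)

lemma interp_continuous:
  assumes h: "h > 0"
  shows "continuous_on UNIV (interp h g)"
proof -
  have cell: "continuous_on {of_int (i - 1) * h..of_int i * h} (interp h g)" for i :: int
  proof -
    obtain a b where "\<forall>x\<in>{of_int (i - 1) * h..of_int i * h}. interp h g x = a * x + b"
      using interp_affine_on_cell[OF h] by blast
    moreover have "continuous_on {of_int (i - 1) * h..of_int i * h} (\<lambda>x. a * x + b)"
      by (intro continuous_intros)
    ultimately show ?thesis by (metis (no_types, lifting) continuous_on_cong)
  qed
  have "isCont (interp h g) x" for x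
  proof -
    define i where "i = \<lfloor>x / h\<rfloor>"
    let ?S = "{of_int (i - 1) * h..of_int i * h} \<union> {of_int ((i + 1) - 1) * h..of_int (i + 1) * h}"
    have "continuous_on ?S (interp h g)"
      by (intro continuous_on_closed_Un cell) auto
    then have c: "continuous_on {of_int (i - 1) * h<..<of_int (i + 1) * h} (interp h g)"
      by (rule continuous_on_subset) auto
    have "of_int i \<le> x / h" "x / h < of_int i + 1"
      unfolding i_def by linarith+
    then have "x \<in> {of_int (i - 1) * h<..<of_int (i + 1) * h}"
      using h by (auto simp: field_simps)
    with c show ?thesis by (simp add: continuous_on_eq_continuous_at)
  qed
  then show ?thesis by (simp add: continuous_on_eq_continuous_at)
qed

lemma interp_in_fe_space:
  assumes h: "h > 0" and N: "L / h \<in> \<nat>" and per: "\<And>x. g (x + L) = g x"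
  shows "interp h g \<in> fe_space L h"
proof -
  obtain N where "L / h = of_nat N" using N by (auto elim: Nats_cases)
  then have L: "L / h = of_int (int N)" "L = of_int (int N) * h" using h by (auto simp: field_simps)
  have *: "nodal h g (k + int N) = nodal h g k" for k
    using per[of "of_int k * h"] by (simp add: nodal_def L(2) algebra_simps)
  have "interp h g (x + L) = interp h g x" for x
    using *[of "\<lfloor>x / h\<rfloor>"] *[of "\<lfloor>x / h\<rfloor> + 1"]
    by (simp add: interp_def add_divide_distrib L(1) frac_def add.commute add.left_commute)
  with interp_affine_on_cell[OF h] interp_continuous[OF h] show ?thesis
    by (simp add: fe_space_def)
qed

end

theory Submission
  imports Defs
begin

text \<open>
  The estimate already holds node by node. At a node let \<open>x\<close> and \<open>y\<close> be the forward and backward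
  difference quotients of \<open>u\<close>, and let \<open>P\<close>, \<open>R\<close>, \<open>S\<close> be the values of \<open>u powr (n - 3)\<close> at the
  node and at its right and left neighbours. Testing with \<open>- u powr (- p - 1)\<close> cancels the two
  minus signs, and up to the factor \<open>(n - 2) / 6 * h * u powr (- p - 1)\<close> the node contributes the
  quadratic form
    \<open>P * (x\<^sup>2 + y\<^sup>2) + ((P + R) * x + (S + P) * y) * ((x + y) / 2)\<close>.
  Its second part is indefinite in general. However, \<open>n < 3\<close> makes \<open>u powr (n - 3)\<close> a decreasing function
  of \<open>u\<close>, so the order of \<open>P\<close>, \<open>R\<close>, \<open>S\<close> is tied to the signs of \<open>x\<close>, \<open>y\<close> and \<open>x + y\<close>. The second
  part can then be negative only at a local minimum of \<open>u\<close>, where \<open>R\<close> and \<open>S\<close> are at most \<open>P\<close>, and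
  half of the first part absorbs it (lemma \<open>quadratic_form_coercive\<close>). The other half is bounded
  below by \<open>P * x\<^sup>2 / 2\<close>, which gives the constant \<open>1 / 12\<close>.
\<close>

text \<open>
  Twice the difference of the two sides is
  \<open>P * (x\<^sup>2 + y\<^sup>2 + (x + y)\<^sup>2) + (R * x + S * y) * (x + y)\<close>, where only the second summand can be
  negative. It is nonnegative if \<open>x\<close> and \<open>y\<close> have equal signs.
  If \<open>x \<le> 0 \<le> y\<close> (a local maximum), the larger of the two differences carries the larger weight,
  which again gives a nonnegative product. If \<open>y \<le> 0 \<le> x\<close> (a local minimum), all weights are at
  most \<open>P\<close>, and the summand is at least \<open>P * y * (x + y)\<close> or \<open>P * x * (x + y)\<close>, according to the
  sign of \<open>x + y\<close>; adding \<open>P * (x\<^sup>2 + y\<^sup>2 + (x + y)\<^sup>2)\<close> makes either bound a form without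
  negative values.
\<close>

lemma quadratic_form_coercive:
  fixes P R S x y :: real
  assumes nonneg: "0 \<le> P" "0 \<le> R" "0 \<le> S"
    and right: "0 \<le> x \<Longrightarrow> R \<le> P"
    and left: "y \<le> 0 \<Longrightarrow> S \<le> P"
    and up: "0 \<le> x + y \<Longrightarrow> R \<le> S"
    and down: "x + y \<le> 0 \<Longrightarrow> S \<le> R"
  shows "P / 2 * (x\<^sup>2 + y\<^sup>2)
    \<le> P * (x\<^sup>2 + y\<^sup>2) + ((P + R) * x + (S + P) * y) * ((x + y) / 2)"
proof -
  have "0 \<le> P * (x\<^sup>2 + y\<^sup>2 + (x + y)\<^sup>2) + (R * x + S * y) * (x + y)"
  proof -
    have sq: "0 \<le> P * (x\<^sup>2 + y\<^sup>2 + (x + y)\<^sup>2)"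
      using nonneg by simp
    consider "0 \<le> x" "0 \<le> y" | "x \<le> 0" "y \<le> 0" | "x \<le> 0" "0 \<le> y" | "0 \<le> x" "y \<le> 0"
      by linarith
    then show ?thesis
    proof cases
      case 1
      then show ?thesis using sq nonneg by simp
    next
      case 2
      then have "R * x + S * y \<le> 0" "x + y \<le> 0"
        using nonneg by (simp_all add: mult_nonneg_nonpos add_nonpos_nonpos)
      then show ?thesis using sq by (simp add: mult_nonpos_nonpos)
    next
      case 3
      have "0 \<le> (R * x + S * y) * (x + y)"
      proof (cases "0 \<le> x + y")
        case True
        have "R * (x + y) \<le> R * x + S * y"
          using mult_right_mono[OF up[OF True] \<open>0 \<le> y\<close>] by (simp add: algebra_simps)
        moreover have "0 \<le> R * (x + y)"
          using True nonneg by simp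
        ultimately show ?thesis using True by simp
      next
        case False
        then have neg: "x + y \<le> 0" by simp
        have "R * x + S * y \<le> S * (x + y)"
          using mult_right_mono_neg[OF down[OF neg] \<open>x \<le> 0\<close>] by (simp add: algebra_simps)
        moreover have "S * (x + y) \<le> 0"
          using neg nonneg by (simp add: mult_nonneg_nonpos)
        ultimately show ?thesis using neg by (simp add: mult_nonpos_nonpos)
      qed
      then show ?thesis using sq by simp
    next
      case 4
      show ?thesis
      proof (cases "0 \<le> x + y")
        case True
        have "P * y \<le> S * y"
          using mult_right_mono_neg[OF left[OF \<open>y \<le> 0\<close>] \<open>y \<le> 0\<close>] .
        also have "\<dots> \<le> R * x + S * y"
          using nonneg \<open>0 \<le> x\<close> by simp
        finally have "P * y * (x + y) \<le> (R * x + S * y) * (x + y)"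
          using True by (rule mult_right_mono)
        moreover have "P * (x\<^sup>2 + y\<^sup>2 + (x + y)\<^sup>2) + P * y * (x + y)
            = P * (2 * (x + 3 / 4 * y)\<^sup>2 + 15 / 8 * y\<^sup>2)"
          by (simp add: power2_eq_square algebra_simps)
        moreover have "0 \<le> P * (2 * (x + 3 / 4 * y)\<^sup>2 + 15 / 8 * y\<^sup>2)"
          using nonneg by simp
        ultimately show ?thesis by linarith
      next
        case False
        then have neg: "x + y \<le> 0" by simp
        have "R * x + S * y \<le> R * x"
          using nonneg \<open>y \<le> 0\<close> by (simp add: mult_nonneg_nonpos)
        also have "\<dots> \<le> P * x"
          using mult_right_mono[OF right[OF \<open>0 \<le> x\<close>] \<open>0 \<le> x\<close>] .
        finally have "P * x * (x + y) \<le> (R * x + S * y) * (x + y)"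
          using neg by (rule mult_right_mono_neg)
        moreover have "P * (x\<^sup>2 + y\<^sup>2 + (x + y)\<^sup>2) + P * x * (x + y)
            = P * (2 * (y + 3 / 4 * x)\<^sup>2 + 15 / 8 * x\<^sup>2)"
          by (simp add: power2_eq_square algebra_simps)
        moreover have "0 \<le> P * (2 * (y + 3 / 4 * x)\<^sup>2 + 15 / 8 * x\<^sup>2)"
          using nonneg by simp
        ultimately show ?thesis by linarith
      qed
    qed
  qed
  then have "0 \<le> (P * (x\<^sup>2 + y\<^sup>2 + (x + y)\<^sup>2) + (R * x + S * y) * (x + y)) / 2"
    by (rule divide_nonneg_pos) simp
  moreover have "P * (x\<^sup>2 + y\<^sup>2) + ((P + R) * x + (S + P) * y) * ((x + y) / 2)
      = P / 2 * (x\<^sup>2 + y\<^sup>2)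
        + (P * (x\<^sup>2 + y\<^sup>2 + (x + y)\<^sup>2) + (R * x + S * y) * (x + y)) / 2"
    by (simp add: power2_eq_square field_simps)
  ultimately show ?thesis by (metis le_add_same_cancel1)
qed

text \<open>
  For a nonpositive exponent the power function is decreasing, which is what the order hypotheses
  of \<open>quadratic_form_coercive\<close> express.
\<close>

lemma powr_node_estimate:
  fixes a b c h q :: real
  assumes pos: "0 < a" "0 < b" "0 < c" and h: "0 < h" and q: "q \<le> 0"
  shows "b powr q / 2 * ((c - b) / h)\<^sup>2
    \<le> b powr q * (((b - a) / h)\<^sup>2 + ((c - b) / h)\<^sup>2)
      + ((b powr q + c powr q) * ((c - b) / h) + (a powr q + b powr q) * ((b - a) / h))
        * ((c - a) / (2 * h))"
proof -
  define x y where "x = (c - b) / h" and "y = (b - a) / h"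
  have xy: "x + y = (c - a) / h"
    by (simp add: x_def y_def add_divide_distrib[symmetric])
  have "b powr q / 2 * x\<^sup>2 \<le> b powr q / 2 * (x\<^sup>2 + y\<^sup>2)"
    by (intro mult_left_mono) auto
  also have "\<dots> \<le> b powr q * (x\<^sup>2 + y\<^sup>2)
      + ((b powr q + c powr q) * x + (a powr q + b powr q) * y) * ((x + y) / 2)"
  proof (rule quadratic_form_coercive)
    assume "0 \<le> x"
    then show "c powr q \<le> b powr q"
      using pos h q by (intro powr_mono2') (auto simp: x_def zero_le_divide_iff)
  next
    assume "y \<le> 0"
    then show "a powr q \<le> b powr q"
      using pos h q by (intro powr_mono2') (auto simp: y_def divide_le_0_iff)
  next
    assume "0 \<le> x + y"
    then show "c powr q \<le> a powr q"
      using pos h q by (intro powr_mono2') (auto simp: xy zero_le_divide_iff)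
  next
    assume "x + y \<le> 0"
    then show "a powr q \<le> c powr q"
      using pos h q by (intro powr_mono2') (auto simp: xy divide_le_0_iff)
  qed simp_all
  also have "(x + y) / 2 = (c - a) / (2 * h)"
    by (simp add: xy)
  finally show ?thesis
    by (simp add: x_def y_def add.commute)
qed

theorem lemma6p3:
  fixes L n p cF :: real
  assumes "L > 0" and "2 < n" and "n < 3" and "p > n" and "cF > 0"
  shows "\<exists>cp>0. \<forall>h>0. L / h \<in> \<nat> \<longrightarrow>
    (\<forall>u\<in>fe_space L h. (\<forall>x. u x > 0) \<longrightarrow>
       energy L cF p h u \<le> cF * h powr (- (p - 2) / (p + 2)) \<longrightarrow>
       A_Delta L n h u (\<lambda>x. - interp h (\<lambda>y. u y powr (- p - 1)) x)
       \<ge> cp * (n - 2) * h * (\<Sum>i=1..num_cells L h.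
            nodal h u i powr (n - p - 4) * \<bar>(nodal h u (i + 1) - nodal h u i) / h\<bar>\<^sup>2))"
proof (intro exI conjI allI impI ballI)
  show "0 < (1 / 12 :: real)" by simp
next
  fix h :: real and u :: "real \<Rightarrow> real"
  assume h: "h > 0" and pos: "\<forall>x. u x > 0"
  define U where "U = nodal h u"
  let ?v = "\<lambda>x. - interp h (\<lambda>y. u y powr (- p - 1)) x"
  define X where "X = (\<lambda>i. U i powr (n - 3) *
    (\<bar>(U i - U (i - 1)) / h\<bar>\<^sup>2 + \<bar>(U (i + 1) - U i) / h\<bar>\<^sup>2))"
  define Y where "Y = (\<lambda>i. ((U i powr (n - 3) + U (i + 1) powr (n - 3)) * ((U (i + 1) - U i) / h)
      + (U (i - 1) powr (n - 3) + U i powr (n - 3)) * ((U i - U (i - 1)) / h))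
    * ((U (i + 1) - U (i - 1)) / (2 * h)))"
  define W where "W = (\<lambda>i. U i powr (- p - 1))"
  have Upos: "0 < U i" for i
    using pos by (simp add: U_def nodal_def)
  have V: "nodal h ?v i = - W i" for i
    using nodal_interp[OF h, of "\<lambda>y. u y powr (- p - 1)" i]
    by (simp add: nodal_def U_def W_def)
  have A: "A_Delta L n h u ?v = (n - 2) / 6 * h * (\<Sum>i=1..num_cells L h. (X i + Y i) * W i)"
  proof -
    have "A_Delta L n h u ?v = - ((n - 2) / 6) * h * (\<Sum>i=1..num_cells L h. X i * - W i)
        - (n - 2) / 6 * h * (\<Sum>i=1..num_cells L h. Y i * - W i)"
      unfolding A_Delta_def Let_def V U_def[symmetric] X_def Y_def ..
    then show ?thesis
      by (simp add: sum_negf sum.distrib distrib_left distrib_right)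
  qed
  have node: "1 / 2 * (U i powr (n - p - 4) * \<bar>(U (i + 1) - U i) / h\<bar>\<^sup>2) \<le> (X i + Y i) * W i" for i
  proof -
    have split: "U i powr (n - p - 4) = U i powr (n - 3) * W i"
      using powr_add[of "U i" "n - 3" "- p - 1"] by (simp add: W_def algebra_simps)
    have "U i powr (n - 3) / 2 * ((U (i + 1) - U i) / h)\<^sup>2 \<le> X i + Y i"
      unfolding X_def Y_def power2_abs
      by (intro powr_node_estimate Upos h) (use \<open>n < 3\<close> in simp)
    from mult_right_mono[OF this, of "W i"] show ?thesis
      unfolding split power2_abs by (simp add: W_def mult_ac)
  qed
  let ?D = "\<Sum>i=1..num_cells L h. U i powr (n - p - 4) * \<bar>(U (i + 1) - U i) / h\<bar>\<^sup>2"
  have "1 / 2 * ?D \<le> (\<Sum>i=1..num_cells L h. (X i + Y i) * W i)"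
    unfolding sum_distrib_left by (intro sum_mono node)
  then have "(n - 2) / 6 * h * (1 / 2 * ?D) \<le> A_Delta L n h u ?v"
    unfolding A using h \<open>2 < n\<close> by (intro mult_left_mono) auto
  then show "1 / 12 * (n - 2) * h * (\<Sum>i=1..num_cells L h.
      nodal h u i powr (n - p - 4) * \<bar>(nodal h u (i + 1) - nodal h u i) / h\<bar>\<^sup>2)
    \<le> A_Delta L n h u ?v"
    unfolding U_def by (simp add: mult_ac)
qed

end
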